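(* Let $A$ and $B$ be infinite homogeneous Boolean algebras such that $\omega_1 \leq \mathfrak{a}(A)$ and $\omega_1\leq\mathfrak{a}(B)$. Then $$\min\{\mathfrak{a}(A),\mathfrak{a}(B),\max\{\mathfrak{s}(A),\mathfrak{s}(B)\}\}\leq\mathfrak{a}(A\oplus B).$$
   Context: For a Boolean algebra $A$, $A^+=A\setminus\{0\}$. A partition of $A$ is a set $P\subseteq A^+$ with $a\cdot b=0$ for distinct $a,b\in P$ and such that every $x\in A^+$ meets some element of $P$. For an infinite Boolean algebra $A$, $\mathfrak{a}(A)$ is the smallest cardinality of an infinite partition of $A$. A Boolean algebra $A$ is homogeneous if for every nonzero $x\in A$ the relative algebra $A\upharpoonright x=\{y\in A: y\le x\}$ (with top $x$ and complement $y\mapsto (-y)\cdot x$) is isomorphic to $A$. (An infinite homogeneous algebra is atomless.) For an atomless Boolean algebra $A$, a family $P\subseteq A^+$ is splitting if for every $x\in A^+$ there is $y\in P$ with $x\cdot y\neq0\neq x\cdot(-y)$; $\mathfrak{s}(A)$ is the least size of a splitting family. $A\oplus B$ denotes the free product of $A$ and $B$: the Boolean algebra $C$ generated by copies $A'\cong A$, $B'\cong B$ of $A$ and $B$ such that $a\cdot b\neq 0$ for all nonzero $a\in A'$, $b\in B'$; equivalently, if $A,B$ are the clopen algebras of Stone spaces $X,Y$, then $A\oplus B$ is the clopen algebra of $X\times Y$. *)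

theory Defs
  imports Complex_Main
begin

unbundle cardinal_syntax

text \<open>
  Boolean algebras are the types of class \<open>boolean_algebra\<close>; \<open>A\<^sup>+\<close> is the set of elements
  different from \<open>bot\<close>.  Cardinals are the cardinal orders of the library, compared across
  types by \<open>\<le>o\<close>; \<open>\<omega>\<^sub>1\<close> is \<open>cardSuc natLeq\<close>.
\<close>

subsection \<open>Cardinals\<close>

text \<open>The smallest cardinality of a member of a nonempty family of sets.\<close>

definition least_card :: "'a set set \<Rightarrow> 'a rel" where
  "least_card F = |SOME P. P \<in> F \<and> (\<forall>Q\<in>F. |P| \<le>o |Q| )|"

lemma least_card_props:
  fixes F :: "'a set set"
  assumes "F \<noteq> {}"
  shows least_card_attained: "\<exists>P\<in>F. least_card F = |P|"
    and least_card_le: "Q \<in> F \<Longrightarrow> least_card F \<le>o |Q|"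
proof -
  have "\<exists>r \<in> card_of ` F. \<forall>r' \<in> card_of ` F. r \<le>o r'"
    by (rule exists_minim_Well_order) (use assms card_of_Well_order in auto)
  then have "\<exists>P. P \<in> F \<and> (\<forall>Q\<in>F. |P| \<le>o |Q| )"
    by auto
  from someI_ex[OF this]
  show "\<exists>P\<in>F. least_card F = |P|" and "Q \<in> F \<Longrightarrow> least_card F \<le>o |Q|"
    by (auto simp: least_card_def)
qed

text \<open>
  Minimum and maximum of two cardinals that may live on different types: the result is an
  isomorphic copy of one of the two, on the disjoint sum of the types.
\<close>

definition card_min :: "'a rel \<Rightarrow> 'b rel \<Rightarrow> ('a + 'b) rel" where
  "card_min r s = (if r \<le>o s then |Inl ` Field r| else |Inr ` Field s| )"

definition card_max :: "'a rel \<Rightarrow> 'b rel \<Rightarrow> ('a + 'b) rel" where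
  "card_max r s = (if r \<le>o s then |Inr ` Field s| else |Inl ` Field r| )"

lemma card_of_image_Field_ordIso:
  assumes "Card_order r" and "inj f"
  shows "|f ` Field r| =o r"
proof -
  have "|f ` Field r| =o |Field r|"
    using assms(2) by (meson card_of_ordIsoI inj_on_imp_bij_betw inj_on_subset ordIso_symmetric subset_UNIV)
  then show ?thesis
    using card_of_Field_ordIso[OF assms(1)] ordIso_transitive by blast
qed

lemma card_min_ordIso:
  assumes "Card_order r" and "Card_order s"
  shows "r \<le>o s \<Longrightarrow> card_min r s =o r" and "\<not> r \<le>o s \<Longrightarrow> card_min r s =o s"
  using assms by (auto simp: card_min_def intro!: card_of_image_Field_ordIso)

lemma card_max_ordIso:
  assumes "Card_order r" and "Card_order s"
  shows "r \<le>o s \<Longrightarrow> card_max r s =o s" and "\<not> r \<le>o s \<Longrightarrow> card_max r s =o r"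
  using assms by (auto simp: card_max_def intro!: card_of_image_Field_ordIso)

subsection \<open>Partitions and splitting families\<close>

definition ba_partition :: "'a::boolean_algebra set \<Rightarrow> bool" where
  "ba_partition P \<longleftrightarrow>
     bot \<notin> P \<and>
     (\<forall>a\<in>P. \<forall>b\<in>P. a \<noteq> b \<longrightarrow> inf a b = bot) \<and>
     (\<forall>x. x \<noteq> bot \<longrightarrow> (\<exists>a\<in>P. inf x a \<noteq> bot))"

definition partition_number :: "'a::boolean_algebra itself \<Rightarrow> 'a rel" where
  "partition_number _ = least_card {P. ba_partition P \<and> infinite P}"

definition splitting_family :: "'a::boolean_algebra set \<Rightarrow> bool" where
  "splitting_family P \<longleftrightarrow>
     bot \<notin> P \<and> (\<forall>x. x \<noteq> bot \<longrightarrow> (\<exists>y\<in>P. inf x y \<noteq> bot \<and> inf x (- y) \<noteq> bot))"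

definition splitting_number :: "'a::boolean_algebra itself \<Rightarrow> 'a rel" where
  "splitting_number _ = least_card {P. splitting_family P}"

subsection \<open>Homogeneous algebras\<close>

text \<open>
  \<open>f\<close> is an isomorphism from the relative algebra below \<open>x\<close>, whose top is \<open>x\<close> and whose
  complement is \<open>y \<mapsto> (- y) \<sqinter> x\<close>, onto a Boolean algebra.
\<close>

definition relative_iso :: "'a::boolean_algebra \<Rightarrow> ('a \<Rightarrow> 'b::boolean_algebra) \<Rightarrow> bool" where
  "relative_iso x f \<longleftrightarrow>
     bij_betw f {y. y \<le> x} UNIV \<and>
     f bot = bot \<and> f x = top \<and>
     (\<forall>y\<le>x. \<forall>z\<le>x. f (inf y z) = inf (f y) (f z) \<and> f (sup y z) = sup (f y) (f z)) \<and>
     (\<forall>y\<le>x. f (inf (- y) x) = - f y)"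

definition homogeneous_ba :: "'a::boolean_algebra itself \<Rightarrow> bool" where
  "homogeneous_ba _ \<longleftrightarrow> (\<forall>x::'a. x \<noteq> bot \<longrightarrow> (\<exists>f :: 'a \<Rightarrow> 'a. relative_iso x f))"

subsection \<open>Free products\<close>

definition ba_hom :: "('a::boolean_algebra \<Rightarrow> 'b::boolean_algebra) \<Rightarrow> bool" where
  "ba_hom f \<longleftrightarrow>
     f bot = bot \<and> f top = top \<and>
     (\<forall>x y. f (inf x y) = inf (f x) (f y)) \<and>
     (\<forall>x y. f (sup x y) = sup (f x) (f y)) \<and>
     (\<forall>x. f (- x) = - f x)"

definition ba_subalgebra :: "'a::boolean_algebra set \<Rightarrow> bool" where
  "ba_subalgebra S \<longleftrightarrow>
     bot \<in> S \<and> top \<in> S \<and>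
     (\<forall>x\<in>S. \<forall>y\<in>S. inf x y \<in> S \<and> sup x y \<in> S) \<and>
     (\<forall>x\<in>S. - x \<in> S)"

text \<open>
  The type \<open>'c\<close>, with the embeddings \<open>i\<close> and \<open>j\<close> of the factors, is a free product of \<open>'a\<close>
  and \<open>'b\<close>.  This determines \<open>'c\<close> up to isomorphism over the factors.
\<close>

definition free_product ::
  "('a::boolean_algebra \<Rightarrow> 'c::boolean_algebra) \<Rightarrow> ('b::boolean_algebra \<Rightarrow> 'c) \<Rightarrow> bool" where
  "free_product i j \<longleftrightarrow>
     ba_hom i \<and> inj i \<and> ba_hom j \<and> inj j \<and>
     ba_subalgebra hull (range i \<union> range j) = UNIV \<and>
     (\<forall>a b. a \<noteq> bot \<longrightarrow> b \<noteq> bot \<longrightarrow> inf (i a) (j b) \<noteq> bot)"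

end

theory Submission
  imports Defs
begin

text \<open>
  Let \<open>P\<close> be an infinite partition of the free product with \<open>|P|\<close> smaller than \<open>\<aa>(A)\<close>, \<open>\<aa>(B)\<close>
  and, say, \<open>\<ss>(A)\<close>; we may assume that it consists of rectangles \<open>a\<^sub>q \<times> b\<^sub>q\<close>.  As the sides
  \<open>a\<^sub>q\<close> split below no element (homogeneity), densely many \<open>x\<close> decide all of them.  For such \<open>x\<close>
  the sides \<open>b\<^sub>q\<close> with \<open>x \<le> a\<^sub>q\<close> form a partition of \<open>B\<close>, so the set \<open>S x\<close> of these \<open>q\<close> is
  finite.  Since no partition properly contains another one, the finite meets of the \<open>a\<^sub>q\<close>,
  \<open>q \<in> S x\<close>, are pairwise equal or disjoint.  They form a partition of \<open>A\<close> with at most \<open>|P|\<close>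
  elements, which is therefore finite; but every \<open>q\<close> lies in some \<open>S x\<close>, so \<open>P\<close> is finite.
\<close>

subsection \<open>Cardinals\<close>

lemma Card_order_least_card: "Card_order (least_card F)"
  by (simp add: least_card_def card_of_Card_order)

lemma Card_order_card_min: "Card_order (card_min r s)"
  by (simp add: card_min_def card_of_Card_order)

lemma Card_order_card_max: "Card_order (card_max r s)"
  by (simp add: card_max_def card_of_Card_order)

lemma card_min_ordLeq:
  assumes r: "Card_order r" and s: "Card_order s" and t: "r \<le>o t \<or> s \<le>o t"
  shows "card_min r s \<le>o t"
proof (cases "r \<le>o s")
  case True
  then have "r \<le>o t" using t ordLeq_transitive by blast
  then show ?thesis using card_min_ordIso(1)[OF r s True] ordIso_ordLeq_trans by blast
next
  case False
  then have "s \<le>o r" using ordLeq_total[of s r] r s by (auto simp: card_order_on_def)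
  then have "s \<le>o t" using t ordLeq_transitive by blast
  then show ?thesis using card_min_ordIso(2)[OF r s False] ordIso_ordLeq_trans by blast
qed

lemma card_max_ordLeq:
  assumes r: "Card_order r" and s: "Card_order s" and "r \<le>o t" "s \<le>o t"
  shows "card_max r s \<le>o t"
  by (cases "r \<le>o s") (use assms card_max_ordIso[OF r s] in \<open>blast intro: ordIso_ordLeq_trans\<close>)+

lemma partition_number_le:
  fixes P :: "'a::boolean_algebra set"
  assumes "ba_partition P" and "infinite P"
  shows "partition_number TYPE('a) \<le>o |P|"
  unfolding partition_number_def by (rule least_card_le) (use assms in auto)

lemma splitting_number_le:
  fixes P :: "'a::boolean_algebra set"
  assumes "splitting_family P"
  shows "splitting_number TYPE('a) \<le>o |P|"
  unfolding splitting_number_def by (rule least_card_le) (use assms in auto)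

text \<open>\<open>M n\<close> collects the meets of \<open>n\<close> members of \<open>F\<close>,
  repetitions allowed; starting from \<open>top\<close> makes the empty meet available. A countable
  union of sets of size at most \<open>|Q|\<close> is no larger, as \<open>Q\<close> is infinite.
  The clause on \<open>w\<close> characterises \<open>c\<close> as the meet of \<open>S\<close> by
  its lower bounds.\<close>

lemma finite_meets_small:
  fixes F :: "'a::boolean_algebra set"
  assumes Q: "infinite Q" and F: "|F| \<le>o |Q|"
  obtains M where "|M| \<le>o |Q|"
    and "\<forall>S. finite S \<and> S \<subseteq> F \<longrightarrow> (\<exists>c\<in>M. \<forall>w. w \<le> c \<longleftrightarrow> (\<forall>a\<in>S. w \<le> a))"
proof -
  define M where "M = rec_nat {top} (\<lambda>_ X. (\<lambda>(a, m). inf a m) ` (F \<times> X))"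
  have M0: "M 0 = {top}" and MS: "M (Suc n) = (\<lambda>(a, m). inf a m) ` (F \<times> M n)" for n
    by (simp_all add: M_def)
  have "|M n| \<le>o |Q|" for n
  proof (induction n)
    case 0
    show ?case using Q by (auto simp: M0 intro!: card_of_singl_ordLeq)
  next
    case (Suc n)
    have "|F \<times> M n| \<le>o |Q|" using card_of_Times_ordLeq_infinite_Field[OF _ F Suc.IH card_of_Card_order] Q
      by (simp add: Field_card_of)
    then show ?case unfolding MS using card_of_image ordLeq_transitive by blast
  qed
  moreover have "|UNIV :: nat set| \<le>o |Q|" using Q infinite_iff_card_of_nat by blast
  ultimately have "|\<Union>n. M n| \<le>o |Q|"
    using card_of_UNION_ordLeq_infinite[OF Q] by blast
  moreover have "\<exists>c\<in>\<Union>n. M n. \<forall>w. w \<le> c \<longleftrightarrow> (\<forall>a\<in>S. w \<le> a)" if "finite S" "S \<subseteq> F" for S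
    using that
  proof (induction S)
    case empty
    show ?case using M0 by (intro bexI[of _ top]) auto
  next
    case (insert a S)
    then obtain c n where c: "c \<in> M n" "\<forall>w. w \<le> c \<longleftrightarrow> (\<forall>a\<in>S. w \<le> a)" by auto
    have "inf a c \<in> M (Suc n)" unfolding MS using c insert.prems by force
    then show ?case using c(2) by (intro bexI[of _ "inf a c"]) auto
  qed
  ultimately show ?thesis by (intro that[of "\<Union>n. M n"] allI impI) simp_all
qed

subsection \<open>Antichains and homogeneous algebras\<close>

lemma inf_compl_bot_iff: "inf x (- y) = bot \<longleftrightarrow> x \<le> (y :: 'a::boolean_algebra)"
  by (metis diff_eq diff_shunt_var)

text \<open>Zorn's lemma gives a maximal antichain above \<open>D\<close>. It is a partition,
  because a nonzero element disjoint from all its members could be added.\<close>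

lemma antichain_extends_to_partition:
  fixes D :: "'a::boolean_algebra set"
  assumes "bot \<notin> D" and "\<forall>a\<in>D. \<forall>b\<in>D. a \<noteq> b \<longrightarrow> inf a b = bot"
  obtains P where "ba_partition P" "D \<subseteq> P"
proof -
  define \<A> where
    "\<A> = {P. D \<subseteq> P \<and> bot \<notin> P \<and> (\<forall>a\<in>P. \<forall>b\<in>P. a \<noteq> b \<longrightarrow> inf a b = bot)}"
  have "\<exists>M\<in>\<A>. \<forall>X\<in>\<A>. M \<subseteq> X \<longrightarrow> X = M"
  proof (rule subset_Zorn_nonempty)
    show "\<A> \<noteq> {}" using assms by (auto simp: \<A>_def)
    show "\<Union>\<C> \<in> \<A>" if "\<C> \<noteq> {}" "subset.chain \<A> \<C>" for \<C>
    proof -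
      have sub: "\<C> \<subseteq> \<A>" and ch: "\<And>X Y. X \<in> \<C> \<Longrightarrow> Y \<in> \<C> \<Longrightarrow> X \<subseteq> Y \<or> Y \<subseteq> X"
        using that by (auto simp: subset_chain_def)
      have "inf a b = bot" if "a \<in> \<Union>\<C>" "b \<in> \<Union>\<C>" "a \<noteq> b" for a b
      proof -
        from that obtain X Y where XY: "X \<in> \<C>" "a \<in> X" "Y \<in> \<C>" "b \<in> Y" by blast
        from ch[OF XY(1,3)] show ?thesis
          using XY sub that(3) unfolding \<A>_def by blast
      qed
      moreover have "D \<subseteq> X" "bot \<notin> X" if "X \<in> \<C>" for X using sub that by (auto simp: \<A>_def)
      then have "D \<subseteq> \<Union>\<C>" "bot \<notin> \<Union>\<C>" using that(1) by blast+
      ultimately show ?thesis by (simp add: \<A>_def)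
    qed
  qed
  then obtain P where P: "P \<in> \<A>" and max: "\<And>X. X \<in> \<A> \<Longrightarrow> P \<subseteq> X \<Longrightarrow> X = P" by blast
  have "\<exists>a\<in>P. inf x a \<noteq> bot" if x: "x \<noteq> bot" for x
  proof (rule ccontr)
    assume n: "\<not> ?thesis"
    then have "insert x P \<in> \<A>" using P x unfolding \<A>_def by (auto simp: inf_commute)
    then have "x \<in> P" using max by blast
    then show False using n x by auto
  qed
  then show ?thesis using that[of P] P unfolding \<A>_def ba_partition_def by blast
qed

text \<open>Below an atom there are only two elements, whereas the relative algebra below
  \<open>x\<close> is in bijection with the whole infinite algebra.\<close>

lemma homogeneous_atomless:
  fixes x :: "'a::boolean_algebra"
  assumes "homogeneous_ba TYPE('a)" and "infinite (UNIV :: 'a set)" and "x \<noteq> bot"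
  obtains y where "y \<le> x" "y \<noteq> x" "y \<noteq> bot"
proof -
  obtain f :: "'a \<Rightarrow> 'a" where "bij_betw f {y. y \<le> x} UNIV"
    using assms(1,3) unfolding homogeneous_ba_def relative_iso_def by blast
  then have "infinite {y. y \<le> x}" using assms(2) bij_betw_finite by blast
  then have "\<not> {y. y \<le> x} \<subseteq> {bot, x}" using finite_subset by blast
  then show ?thesis using that by blast
qed

text \<open>Atomlessness gives a strictly decreasing sequence of nonzero elements from
  \<open>top\<close>; its successive differences are the antichain.\<close>

lemma homogeneous_infinite_antichain:
  assumes "homogeneous_ba TYPE('a::boolean_algebra)" and "infinite (UNIV :: 'a set)"
  obtains d :: "nat \<Rightarrow> 'a::boolean_algebra" where "\<And>n. d n \<noteq> bot" "\<And>m n. m \<noteq> n \<Longrightarrow> inf (d m) (d n) = bot"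
proof -
  have "\<exists>y. y \<noteq> bot \<and> y \<le> x \<and> y \<noteq> x" if "x \<noteq> bot" for x :: 'a
    using homogeneous_atomless[OF assms that] by metis
  then obtain s where s: "\<And>x :: 'a. x \<noteq> bot \<Longrightarrow> s x \<noteq> bot \<and> s x \<le> x \<and> s x \<noteq> x" by metis
  define x where "x n = (s ^^ n) top" for n
  have "(top :: 'a) \<noteq> bot"
  proof
    assume "(top :: 'a) = bot"
    then have "(UNIV :: 'a set) \<subseteq> {bot}" by (metis bot.extremum_uniqueI insertI1 subsetI top_greatest)
    then show False using assms(2) finite_subset by blast
  qed
  then have nb: "x n \<noteq> bot" for n by (induction n) (auto simp: x_def s)
  have step: "x (Suc n) \<le> x n" "x (Suc n) \<noteq> x n" for n
    using s[OF nb[of n]] by (auto simp: x_def)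
  have anti: "x n \<le> x m" if "m \<le> n" for m n
    using lift_Suc_antimono_le[of x] step(1) that by blast
  have disj: "inf (inf (x m) (- x (Suc m))) (inf (x n) (- x (Suc n))) = bot" if "m < n" for m n
  proof -
    \<comment> \<open>Since \<open>m < n\<close>, \<open>x n\<close> already lies below
      \<open>x (Suc m)\<close>, the part removed in the \<open>m\<close>-th difference.\<close>
    have "inf (x n) (- x (Suc m)) = bot" using anti[of "Suc m" n] that by (simp add: inf_compl_bot_iff)
    then show ?thesis by (metis inf.assoc inf.commute inf_bot_left)
  qed
  show ?thesis
  proof (rule that)
    show "inf (x n) (- x (Suc n)) \<noteq> bot" for n
      unfolding inf_compl_bot_iff using step[of n] by (metis order.antisym)
    show "inf (inf (x m) (- x (Suc m))) (inf (x n) (- x (Suc n))) = bot" if "m \<noteq> n" for m n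
      using that disj[of m n] disj[of n m] by (metis inf.commute linorder_neqE_nat)
  qed
qed

text \<open>A family that is too small to be splitting leaves some nonzero element unsplit, but that
  element could lie anywhere. Carrying the traces of \<open>F\<close> on \<open>y\<close> through an
  isomorphism of the relative algebra with the whole one places it below the given
  \<open>y\<close>.\<close>

lemma homogeneous_not_split_below:
  fixes F :: "'a::boolean_algebra set"
  assumes hom: "homogeneous_ba TYPE('a)"
    and small: "|F| \<le>o t" and ns: "\<not> splitting_number TYPE('a) \<le>o t" and y: "y \<noteq> bot"
  obtains x where "x \<noteq> bot" "x \<le> y" "\<forall>a\<in>F. inf x a = bot \<or> x \<le> a"
proof -
  obtain f :: "'a \<Rightarrow> 'a" where f: "relative_iso y f"
    using hom y unfolding homogeneous_ba_def by blast
  then have bij: "bij_betw f {z. z \<le> y} UNIV" and fbot: "f bot = bot"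
    and finf: "\<And>u v. u \<le> y \<Longrightarrow> v \<le> y \<Longrightarrow> f (inf u v) = inf (f u) (f v)"
    and fcompl: "\<And>u. u \<le> y \<Longrightarrow> f (inf (- u) y) = - f u"
    unfolding relative_iso_def by blast+
  have f0: "u = bot" if "u \<le> y" "f u = bot" for u
    using inj_onD[OF bij_betw_imp_inj_on[OF bij], of u bot] that fbot by simp
  \<comment> \<open>A trace equal to \<open>bot\<close> splits nothing. It is removed so that the
    failure of \<open>splitting_family F'\<close> cannot come from the clause excluding
    \<open>bot\<close>.\<close>
  define F' where "F' = (\<lambda>a. f (inf a y)) ` F - {bot}"
  have "|F'| \<le>o |(\<lambda>a. f (inf a y)) ` F|" unfolding F'_def by (rule card_of_mono1) blast
  then have "|F'| \<le>o t" using card_of_image small ordLeq_transitive by blast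
  then have "\<not> splitting_family F'" using splitting_number_le ns ordLeq_transitive by blast
  moreover have "bot \<notin> F'" by (simp add: F'_def)
  ultimately obtain x where x: "x \<noteq> bot" "\<And>z. z \<in> F' \<Longrightarrow> inf x z = bot \<or> inf x (- z) = bot"
    unfolding splitting_family_def by metis
  have "x \<in> f ` {z. z \<le> y}" using bij_betw_imp_surj_on[OF bij] by simp
  then obtain u where u: "u \<le> y" "f u = x" by auto
  show ?thesis
  proof (rule that[of u])
    show "u \<noteq> bot" using u x fbot by auto
    show "u \<le> y" by fact
    show "\<forall>a\<in>F. inf u a = bot \<or> u \<le> a"
    proof
      fix a assume a: "a \<in> F"
      have ay: "inf a y \<le> y" by simp
      have ua: "inf u (inf a y) = inf u a" using u(1) by (metis inf.absorb1 inf.assoc inf.commute)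
      \<comment> \<open>The complement of the trace of \<open>a\<close> relative to \<open>y\<close>
        agrees with \<open>- a\<close> below \<open>u\<close>.\<close>
      have "inf u (inf (- inf a y) y) = inf u (- a)"
        using u(1) by (simp add: inf_sup_distrib1 inf_sup_distrib2 inf.absorb1 inf.assoc[symmetric])
          (metis inf.absorb1 inf.assoc inf.commute)
      then have uc: "f (inf u (- a)) = inf x (- f (inf a y))"
        using finf[OF u(1), of "inf (- inf a y) y"] fcompl[OF ay] u(2) by simp
      have ui: "f (inf u a) = inf x (f (inf a y))" using finf[OF u(1) ay] ua u(2) by simp
      have le: "inf u v \<le> y" for v using u(1) le_infI1 by blast
      have "f (inf u a) = bot \<or> f (inf u (- a)) = bot"
        unfolding ui uc using x(2) a unfolding F'_def by fastforce
      then show "inf u a = bot \<or> u \<le> a" using f0[OF le] inf_compl_bot_iff by blast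
    qed
  qed
qed

subsection \<open>Free products\<close>

text \<open>Disjointness is built in because the joined pieces later replace a member of a partition
  and must again form an antichain.\<close>

inductive_set disjoint_sups :: "'c::boolean_algebra set \<Rightarrow> 'c set" for R where
  bot: "bot \<in> disjoint_sups R"
| sup: "z \<in> disjoint_sups R \<Longrightarrow> r \<in> R \<Longrightarrow> inf z r = bot \<Longrightarrow> sup z r \<in> disjoint_sups R"

lemma disjoint_sups_sup:
  assumes "w \<in> disjoint_sups R" "z \<in> disjoint_sups R" "inf w z = bot"
  shows "sup w z \<in> disjoint_sups R"
  using assms(2,3)
proof induction
  case bot
  then show ?case using assms(1) by simp
next
  case (sup z r)
  have "inf w z = bot" "inf w r = bot" using sup.prems by (simp_all add: inf_sup_distrib1)
  have "sup (sup w z) r \<in> disjoint_sups R"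
    by (rule disjoint_sups.sup[OF sup.IH[OF \<open>inf w z = bot\<close>] sup.hyps(2)])
      (use \<open>inf w r = bot\<close> sup.hyps(3) in \<open>simp add: inf_sup_distrib2\<close>)
  then show ?case by (simp add: sup_assoc)
qed

lemma disjoint_sups_base: "r \<in> R \<Longrightarrow> r \<in> disjoint_sups R"
  using disjoint_sups.sup[OF disjoint_sups.bot, of r] by simp

text \<open>Meets distribute over the joins, first with one factor a single member of
  \<open>R\<close>, then in general; the pieces stay disjoint because they only shrink.\<close>

lemma disjoint_sups_inf:
  assumes R: "\<And>r s. r \<in> R \<Longrightarrow> s \<in> R \<Longrightarrow> inf r s \<in> R"
    and "w \<in> disjoint_sups R" "z \<in> disjoint_sups R"
  shows "inf w z \<in> disjoint_sups R"
proof -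
  have 1: "inf z s \<in> disjoint_sups R" if "z \<in> disjoint_sups R" and s: "s \<in> R" for z s
    using that(1)
  proof induction
    case bot
    show ?case by (simp add: disjoint_sups.bot)
  next
    case (sup z r)
    have "inf (inf z s) (inf r s) = inf (inf z r) s" by (simp add: inf.commute inf.left_commute)
    then have "inf (inf z s) (inf r s) = bot" using sup by simp
    then show ?case
      using disjoint_sups_sup[OF sup.IH disjoint_sups_base[OF R[OF sup.hyps(2) s]]]
      by (simp add: inf_sup_distrib2)
  qed
  show ?thesis using assms(3)
  proof induction
    case bot
    show ?case by (simp add: disjoint_sups.bot)
  next
    case (sup z r)
    have "inf (inf w z) (inf w r) = inf w (inf z r)" by (simp add: inf.commute inf.left_commute)
    then have "inf (inf w z) (inf w r) = bot" using sup by simp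
    then show ?case
      using disjoint_sups_sup[OF sup.IH 1[OF assms(2) sup.hyps(2)]] by (simp add: inf_sup_distrib1)
  qed
qed

text \<open>De Morgan reduces complements of joins to meets of complements, and then arbitrary
  joins, disjoint or not, to complements and meets.\<close>

lemma disjoint_sups_subalgebra:
  fixes R :: "'c::boolean_algebra set"
  assumes R: "\<And>r s. r \<in> R \<Longrightarrow> s \<in> R \<Longrightarrow> inf r s \<in> R" and top: "top \<in> R"
    and compl: "\<And>r. r \<in> R \<Longrightarrow> - r \<in> disjoint_sups R"
  shows "ba_subalgebra (disjoint_sups R)"
proof -
  have c: "- z \<in> disjoint_sups R" if "z \<in> disjoint_sups R" for z
    using that
  proof induction
    case bot
    show ?case using top by (simp add: disjoint_sups_base)
  next
    case (sup z r)
    show ?case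
      using disjoint_sups_inf[OF R sup.IH compl[OF sup.hyps(2)]] by simp
  qed
  have s: "sup w z \<in> disjoint_sups R" if "w \<in> disjoint_sups R" "z \<in> disjoint_sups R" for w z
    using c[OF disjoint_sups_inf[OF R c[OF that(1)] c[OF that(2)]]] by simp
  show ?thesis
    unfolding ba_subalgebra_def
    using c s disjoint_sups_inf[OF R] disjoint_sups.bot disjoint_sups_base[OF top] by blast
qed

text \<open>The last condition says that \<open>z\<close> is the join of \<open>Q\<close>; finite joins have no notation in this class.\<close>

lemma disjoint_sups_decomp:
  assumes "z \<in> disjoint_sups R"
  obtains Q where "finite Q" "Q \<subseteq> R - {bot}" "\<forall>a\<in>Q. \<forall>b\<in>Q. a \<noteq> b \<longrightarrow> inf a b = bot"
    "\<forall>w. inf w z = bot \<longleftrightarrow> (\<forall>q\<in>Q. inf w q = bot)"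
proof -
  have "\<exists>Q. finite Q \<and> Q \<subseteq> R - {bot} \<and> (\<forall>a\<in>Q. \<forall>b\<in>Q. a \<noteq> b \<longrightarrow> inf a b = bot) \<and>
    (\<forall>w. inf w z = bot \<longleftrightarrow> (\<forall>q\<in>Q. inf w q = bot))"
    using assms
  proof induction
    case bot
    show ?case by (intro exI[of _ "{}"]) auto
  next
    case (sup z r)
    then obtain Q where Q: "finite Q" "Q \<subseteq> R - {bot}" "\<forall>a\<in>Q. \<forall>b\<in>Q. a \<noteq> b \<longrightarrow> inf a b = bot"
      "\<forall>w. inf w z = bot \<longleftrightarrow> (\<forall>q\<in>Q. inf w q = bot)" by blast
    have "\<forall>q\<in>Q. inf r q = bot" using Q(4) sup by (metis inf.commute)
    then show ?case using Q sup.hyps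
      \<comment> \<open>The new piece \<open>r\<close> may itself be \<open>bot\<close>.\<close>
      by (intro exI[of _ "insert r Q - {bot}"]) (auto simp: inf_sup_distrib1 inf.commute)
  qed
  then show ?thesis using that by blast
qed

section \<open>Rectangles in a free product\<close>

text \<open>In the product of the Stone spaces these are the products of a clopen set of each
  factor, the empty one included.\<close>

definition rectangles :: "('a \<Rightarrow> 'c::boolean_algebra) \<Rightarrow> ('b \<Rightarrow> 'c) \<Rightarrow> 'c set" where
  "rectangles i j = {inf (i a) (j b) | a b. True}"

text \<open>Rectangles are closed under meets and contain both factors, so their finite disjoint
  joins form a subalgebra containing the generators once complements of rectangles are such
  joins.\<close>

lemma free_product_disjoint_sups:
  fixes i :: "'a::boolean_algebra \<Rightarrow> 'c::boolean_algebra" and j :: "'b::boolean_algebra \<Rightarrow> 'c"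
  assumes "free_product i j"
  shows "z \<in> disjoint_sups (rectangles i j)"
proof -
  let ?R = "rectangles i j"
  have i: "ba_hom i" and j: "ba_hom j" and hull: "ba_subalgebra hull (range i \<union> range j) = UNIV"
    using assms by (auto simp: free_product_def)
  have rect: "inf (i a) (j b) \<in> ?R" for a b by (auto simp: rectangles_def)
  have ri: "i a \<in> ?R" and rj: "j b \<in> ?R" for a b
    using rect[of a top] rect[of top b] i j by (simp_all add: ba_hom_def)
  have "ba_subalgebra (disjoint_sups ?R)"
  proof (rule disjoint_sups_subalgebra)
    fix r s assume "r \<in> ?R" "s \<in> ?R"
    then obtain a b a' b' where "r = inf (i a) (j b)" "s = inf (i a') (j b')"
      by (auto simp: rectangles_def)
    then have "inf r s = inf (i (inf a a')) (j (inf b b'))"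
      using i j by (simp add: ba_hom_def inf.assoc inf.left_commute)
    then show "inf r s \<in> ?R" using rect by simp
  next
    show "top \<in> ?R" using ri[of top] i by (simp add: ba_hom_def)
  next
    fix r assume "r \<in> ?R"
    then obtain a b where r: "r = inf (i a) (j b)" by (auto simp: rectangles_def)
    \<comment> \<open>The complement of a rectangle is cut into the strip outside \<open>a\<close>
      and the part over \<open>a\<close> outside \<open>b\<close>, which are disjoint.\<close>
    have "- r = sup (- i a) (inf (i a) (- j b))" unfolding r by (simp add: sup_inf_distrib1)
    also have "\<dots> = sup (i (- a)) (inf (i a) (j (- b)))" using i j by (simp add: ba_hom_def)
    also have "\<dots> \<in> disjoint_sups ?R"
    proof (rule disjoint_sups_sup)
      show "inf (i (- a)) (inf (i a) (j (- b))) = bot"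
        using i by (simp add: ba_hom_def inf.assoc[symmetric])
    qed (simp_all add: disjoint_sups_base ri rect)
    finally show "- r \<in> disjoint_sups ?R" .
  qed
  then have "ba_subalgebra hull (range i \<union> range j) \<subseteq> disjoint_sups ?R"
    using ri rj by (intro hull_minimal) (auto intro: disjoint_sups_base)
  then show ?thesis using hull by blast
qed

text \<open>Each member of \<open>P\<close> is replaced by the finitely many disjoint rectangles
  that make it up. As \<open>P\<close> is infinite, this does not raise the cardinality.\<close>

lemma rectangle_refinement:
  fixes i :: "'a::boolean_algebra \<Rightarrow> 'c::boolean_algebra" and j :: "'b::boolean_algebra \<Rightarrow> 'c"
  assumes fp: "free_product i j" and P: "ba_partition (P :: 'c set)" "infinite P"
  obtains Q where "ba_partition Q" "infinite Q" "Q \<subseteq> rectangles i j" "|Q| \<le>o |P|"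
proof -
  have "\<exists>Q. finite Q \<and> Q \<subseteq> rectangles i j - {bot} \<and> (\<forall>a\<in>Q. \<forall>b\<in>Q. a \<noteq> b \<longrightarrow> inf a b = bot) \<and>
      (\<forall>w. inf w z = bot \<longleftrightarrow> (\<forall>q\<in>Q. inf w q = bot))" for z
    by (rule disjoint_sups_decomp[OF free_product_disjoint_sups[OF fp, of z]]) blast
  then obtain Q where Q: "\<And>z. finite (Q z)" "\<And>z. Q z \<subseteq> rectangles i j - {bot}"
    "\<And>z. \<forall>a\<in>Q z. \<forall>b\<in>Q z. a \<noteq> b \<longrightarrow> inf a b = bot"
    and cov: "\<And>z w. inf w z = bot \<longleftrightarrow> (\<forall>q\<in>Q z. inf w q = bot)" by metis
  \<comment> \<open>The join property is tested on the complement of \<open>z\<close>.\<close>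
  have le: "q \<le> z" if "q \<in> Q z" for q z
    using cov[of "- z" z] that by (metis compl_inf_bot inf.commute inf_compl_bot_iff)
  have ne: "Q z \<noteq> {}" if "z \<noteq> bot" for z
    using cov[of z z] that by auto
  have disj: "inf a b = bot" if "p \<in> P" "p' \<in> P" "a \<in> Q p" "b \<in> Q p'" "a \<noteq> b" for a b p p'
  proof (cases "p = p'")
    case True
    then show ?thesis using Q(3) that by blast
  next
    case False
    then have "inf p p' = bot" using P(1) that unfolding ba_partition_def by blast
    then show ?thesis using inf_mono[OF le[OF that(3)] le[OF that(4)]] by (simp add: bot_unique)
  qed
  show ?thesis
  proof (rule that)
    show "ba_partition (\<Union>p\<in>P. Q p)"
      unfolding ba_partition_def
    proof (intro conjI allI ballI impI)
      show "bot \<notin> (\<Union>p\<in>P. Q p)" using Q(2) by blast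
      show "inf a b = bot" if "a \<in> (\<Union>p\<in>P. Q p)" "b \<in> (\<Union>p\<in>P. Q p)" "a \<noteq> b" for a b
        using that disj by blast
      fix x :: 'c assume "x \<noteq> bot"
      then obtain p where "p \<in> P" "inf x p \<noteq> bot" using P(1) unfolding ba_partition_def by blast
      then show "\<exists>a\<in>\<Union>p\<in>P. Q p. inf x a \<noteq> bot" using cov by blast
    qed
    \<comment> \<open>Choosing one rectangle inside each member of \<open>P\<close> is injective,
      since a rectangle inside two disjoint members would be \<open>bot\<close>; hence the
      refinement is infinite.\<close>
    have "\<forall>p\<in>P. \<exists>q. q \<in> Q p" using ne P(1) unfolding ba_partition_def by (metis ex_in_conv)
    then obtain h where h: "\<And>p. p \<in> P \<Longrightarrow> h p \<in> Q p" by metis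
    have "inj_on h P"
    proof (rule inj_onI, rule ccontr)
      fix p p' assume p: "p \<in> P" "p' \<in> P" "h p = h p'" "p \<noteq> p'"
      then have "inf p p' = bot" using P(1) unfolding ba_partition_def by blast
      moreover have "h p \<le> inf p p'" using le[OF h[OF p(1)]] le[OF h[OF p(2)]] p(3) by simp
      ultimately have "h p = bot" by (simp add: bot_unique)
      then show False using h[OF p(1)] Q(2) by blast
    qed
    then have "infinite (h ` P)" using P(2) finite_imageD by blast
    then show "infinite (\<Union>p\<in>P. Q p)" using h finite_subset[of "h ` P"] by blast
    show "(\<Union>p\<in>P. Q p) \<subseteq> rectangles i j" using Q(2) by blast
    have "|Q p| \<le>o |P|" for p
      using finite_ordLess_infinite[OF card_of_Well_order[of "Q p"] card_of_Well_order[of P]] Q(1) P(2)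
      by (simp add: Field_card_of ordLess_imp_ordLeq)
    then show "|\<Union>p\<in>P. Q p| \<le>o |P|" using card_of_UNION_ordLeq_infinite[OF P(2) ordLeq_refl[OF card_of_Card_order]] by blast
  qed
qed

text \<open>Two rectangles meet in the rectangle whose sides are the meets of their sides, and a
  rectangle with nonzero sides is nonzero.\<close>

lemma free_product_inf_bot:
  assumes "free_product i j"
  shows "inf (inf (i a) (j b)) (inf (i a') (j b')) = bot \<longleftrightarrow> inf a a' = bot \<or> inf b b' = bot"
proof -
  have "inf (inf (i a) (j b)) (inf (i a') (j b')) = inf (i (inf a a')) (j (inf b b'))"
    using assms by (simp add: free_product_def ba_hom_def inf.assoc inf.left_commute)
  then show ?thesis using assms unfolding free_product_def ba_hom_def
    by (metis inf_bot_left inf_bot_right)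
qed

lemma free_product_commute:
  "free_product i j \<Longrightarrow> free_product j i"
  by (auto simp: free_product_def Un_commute inf_commute)

section \<open>The bound for one factor\<close>

text \<open>Only the splitting number of the first factor is bounded here; exchanging the factors
  gives the other half of the maximum.\<close>

lemma free_product_partition_bound:
  fixes i :: "'a::boolean_algebra \<Rightarrow> 'c::boolean_algebra" and j :: "'b::boolean_algebra \<Rightarrow> 'c"
  assumes fp: "free_product i j" and hom: "homogeneous_ba TYPE('a)"
    and P: "ba_partition (P :: 'c set)" "infinite P"
    and nA: "\<not> partition_number TYPE('a) \<le>o |P|" and nB: "\<not> partition_number TYPE('b) \<le>o |P|"
  shows "splitting_number TYPE('a) \<le>o |P|"
proof (rule ccontr)
  assume nS: "\<not> ?thesis"
  obtain Q where Q: "ba_partition Q" "infinite Q" "Q \<subseteq> rectangles i j" "|Q| \<le>o |P|"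
    by (rule rectangle_refinement[OF fp P])
  have small_finA: "finite K" if "ba_partition K" "|K| \<le>o |Q|" for K :: "'a set"
    using ordLeq_transitive[OF ordLeq_transitive[OF partition_number_le[OF that(1)] that(2)] Q(4)] nA
    by blast
  have small_finB: "finite K" if "ba_partition K" "|K| \<le>o |Q|" for K :: "'b set"
    using ordLeq_transitive[OF ordLeq_transitive[OF partition_number_le[OF that(1)] that(2)] Q(4)] nB
    by blast
  have "\<forall>q\<in>Q. \<exists>a b. q = inf (i a) (j b)" using Q(3) unfolding rectangles_def by blast
  then obtain \<alpha> \<beta> where ab: "\<And>q. q \<in> Q \<Longrightarrow> q = inf (i (\<alpha> q)) (j (\<beta> q))" by metis
  have meet: "inf q (inf (i a) (j b)) = bot \<longleftrightarrow> inf (\<alpha> q) a = bot \<or> inf (\<beta> q) b = bot"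
    if "q \<in> Q" for q a b
    using free_product_inf_bot[OF fp, of "\<alpha> q" "\<beta> q" a b] ab[OF that] by simp
  have nz: "\<alpha> q \<noteq> bot" "\<beta> q \<noteq> bot" if "q \<in> Q" for q
    using meet[OF that, of "\<alpha> q" "\<beta> q"] ab[OF that] that Q(1) unfolding ba_partition_def by auto
  have disj: "inf (\<alpha> q) (\<alpha> q') = bot \<or> inf (\<beta> q) (\<beta> q') = bot" if "q \<in> Q" "q' \<in> Q" "q \<noteq> q'" for q q'
    using meet[OF that(1), of "\<alpha> q'" "\<beta> q'"] ab[OF that(2)] that Q(1) unfolding ba_partition_def by metis
  \<comment> \<open>\<open>D\<close> consists of the nonzero elements deciding every first side, and
    \<open>S x\<close> of the rectangles whose first side covers \<open>x\<close>.\<close>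
  define D where "D = {x. x \<noteq> bot \<and> (\<forall>q\<in>Q. inf x (\<alpha> q) = bot \<or> x \<le> \<alpha> q)}"
  define S where "S x = {q\<in>Q. x \<le> \<alpha> q}" for x
  have dense: "\<exists>x\<in>D. x \<le> y" if "y \<noteq> bot" for y
  proof -
    have "|\<alpha> ` Q| \<le>o |P|" using card_of_image Q(4) ordLeq_transitive by blast
    then obtain x where "x \<noteq> bot" "x \<le> y" "\<forall>a\<in>\<alpha> ` Q. inf x a = bot \<or> x \<le> a"
      by (rule homogeneous_not_split_below[OF hom _ nS \<open>y \<noteq> bot\<close>])
    then show ?thesis by (auto simp: D_def)
  qed
  have disjS: "inf (\<beta> q) (\<beta> q') = bot" if "x \<in> D" "q \<in> S x" "q' \<in> S x" "q \<noteq> q'" for x q q'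
  proof -
    have "x \<le> inf (\<alpha> q) (\<alpha> q')" "x \<noteq> bot" using that by (auto simp: S_def D_def)
    then have "inf (\<alpha> q) (\<alpha> q') \<noteq> bot" by (metis bot_unique)
    then show ?thesis using disj that unfolding S_def by blast
  qed
  \<comment> \<open>Some member of the partition meets the rectangle of \<open>x\<close> and
    \<open>b\<close>. Its first side meets \<open>x\<close>, hence covers \<open>x\<close> because
    \<open>x\<close> decides it.\<close>
  have hitS: "\<exists>q\<in>S x. inf b (\<beta> q) \<noteq> bot" if "x \<in> D" "b \<noteq> bot" for x b
  proof -
    have "inf (i x) (j b) \<noteq> bot" using fp that by (auto simp: free_product_def D_def)
    then obtain q where q: "q \<in> Q" "inf q (inf (i x) (j b)) \<noteq> bot"
      using Q(1) unfolding ba_partition_def by (metis inf.commute)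
    then have "inf x (\<alpha> q) \<noteq> bot" "inf b (\<beta> q) \<noteq> bot" using meet by (simp_all add: inf.commute)
    then show ?thesis using q that by (auto simp: D_def S_def)
  qed
  have finS: "finite (S x)" if "x \<in> D" for x
  proof -
    have SQ: "S x \<subseteq> Q" by (auto simp: S_def)
    have "ba_partition (\<beta> ` S x)"
      unfolding ba_partition_def using nz SQ disjS[OF that] hitS[OF that] by fastforce
    moreover have "|\<beta> ` S x| \<le>o |Q|" using card_of_image card_of_mono1[OF SQ] ordLeq_transitive by blast
    ultimately have "finite (\<beta> ` S x)" using small_finB by blast
    \<comment> \<open>Finiteness of the set of second sides passes to \<open>S x\<close>: distinct
      members have disjoint nonzero second sides.\<close>
    moreover have "inj_on \<beta> (S x)"
    proof (rule inj_onI, rule ccontr)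
      fix q q' assume "q \<in> S x" "q' \<in> S x" "\<beta> q = \<beta> q'" "q \<noteq> q'"
      then show False using disjS[OF that, of q q'] nz SQ by auto
    qed
    ultimately show ?thesis using finite_imageD by blast
  qed
  have eqS: "S x = S x'" if D: "x \<in> D" "x' \<in> D" and sub: "S x \<subseteq> S x'" for x x'
  proof (rule ccontr)
    assume "S x \<noteq> S x'"
    then obtain q where q: "q \<in> S x'" "q \<notin> S x" using sub by blast
    then have "\<beta> q \<noteq> bot" using nz by (auto simp: S_def)
    \<comment> \<open>The second sides from \<open>S x\<close> already meet everything, so one of
      them meets that of \<open>q\<close>; yet both rectangles belong to \<open>S x'\<close>, where
      second sides are disjoint.\<close>
    then obtain q' where "q' \<in> S x" "inf (\<beta> q) (\<beta> q') \<noteq> bot" using hitS D(1) by blast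
    then show False using disjS[OF D(2)] q sub by blast
  qed
  \<comment> \<open>\<open>D\<close> may be large; choosing the meets inside \<open>M\<close> keeps
    their number at most \<open>|Q|\<close>.\<close>
  obtain M where M: "|M| \<le>o |Q|"
    "\<forall>F. finite F \<and> F \<subseteq> \<alpha> ` Q \<longrightarrow> (\<exists>c\<in>M. \<forall>w. w \<le> c \<longleftrightarrow> (\<forall>a\<in>F. w \<le> a))"
    by (rule finite_meets_small[OF Q(2) card_of_image[of \<alpha> Q]])
  have "\<exists>c\<in>M. \<forall>w. w \<le> c \<longleftrightarrow> S x \<subseteq> S w" if "x \<in> D" for x
  proof -
    have "finite (\<alpha> ` S x) \<and> \<alpha> ` S x \<subseteq> \<alpha> ` Q" using finS[OF that] by (auto simp: S_def)
    from M(2)[rule_format, OF this]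
    obtain c where "c \<in> M" "\<forall>w. w \<le> c \<longleftrightarrow> (\<forall>a\<in>\<alpha> ` S x. w \<le> a)" by (elim bexE)
    then show ?thesis by (intro bexI[of _ c]) (auto simp: S_def)
  qed
  then obtain c where cM: "\<And>x. x \<in> D \<Longrightarrow> c x \<in> M"
    and c: "\<And>x w. x \<in> D \<Longrightarrow> w \<le> c x \<longleftrightarrow> S x \<subseteq> S w" by metis
  have xc: "x \<le> c x" if "x \<in> D" for x using c[OF that] by blast
  \<comment> \<open>\<open>c x\<close> is the largest \<open>w\<close> with \<open>S x\<close>
    contained in \<open>S w\<close>. Passing from \<open>x\<close> up to \<open>c x\<close> loses no
    rectangle by this property, and gains none because \<open>S\<close> reverses order.\<close>
  have Sc: "S (c x) = S x" if "x \<in> D" for x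
    using c[OF that, of "c x"] xc[OF that] by (auto simp: S_def)
  have "ba_partition (c ` D)"
    unfolding ba_partition_def
  proof (intro conjI ballI allI impI)
    show "bot \<notin> c ` D" using xc by (metis (mono_tags, lifting) D_def bot_unique imageE mem_Collect_eq)
  next
    fix u v assume "u \<in> c ` D" "v \<in> c ` D" and ne: "u \<noteq> v"
    then obtain x y where xy: "x \<in> D" "u = c x" "y \<in> D" "v = c y" by blast
    show "inf u v = bot"
    proof (rule ccontr)
      assume "inf u v \<noteq> bot"
      then obtain z where z: "z \<in> D" "z \<le> u" "z \<le> v" using dense by (metis le_inf_iff)
      \<comment> \<open>Lying below both meets puts \<open>S x\<close> and \<open>S y\<close> inside
        \<open>S z\<close>, and such inclusions are equalities; so overlapping meets come from the
        same set of rectangles.\<close>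
      then have "S x = S z" "S y = S z" using c eqS xy by blast+
      then have "u \<le> v" "v \<le> u" using xy c Sc by simp_all
      then show False using ne by simp
    qed
  next
    fix x :: 'a assume "x \<noteq> bot"
    then obtain y where "y \<in> D" "y \<le> x" using dense by blast
    then have "y \<le> inf x (c y)" "y \<noteq> bot" using xc by (auto simp: D_def)
    then show "\<exists>a\<in>c ` D. inf x a \<noteq> bot" using \<open>y \<in> D\<close> by (metis bot_unique imageI)
  qed
  moreover have "|c ` D| \<le>o |Q|"
    using card_of_mono1[of "c ` D" M] cM M(1) ordLeq_transitive by blast
  ultimately have "finite (c ` D)" using small_finA by blast
  \<comment> \<open>Finitely many meets, each with a finite set of rectangles, would account for all
    of \<open>Q\<close>: by density every first side lies above some element of
    \<open>D\<close>.\<close>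
  then have "finite (\<Union>k\<in>c ` D. S k)" by (rule finite_UN_I) (use Sc finS in auto)
  moreover have "Q \<subseteq> (\<Union>k\<in>c ` D. S k)"
  proof
    fix q assume q: "q \<in> Q"
    then obtain x where x: "x \<in> D" "x \<le> \<alpha> q" using dense nz by blast
    then have "q \<in> S (c x)" unfolding Sc[OF x(1)] using q by (simp add: S_def)
    then show "q \<in> (\<Union>k\<in>c ` D. S k)" using x(1) by blast
  qed
  ultimately show False using Q(2) finite_subset by blast
qed

section \<open>Existence of infinite partitions and conclusion\<close>

text \<open>The embedding \<open>i\<close> carries an infinite antichain into the free product,
  where it extends to a partition. This makes the family whose least cardinality is
  \<open>partition_number TYPE('c)\<close> nonempty, so that the minimum is attained.\<close>

lemma free_product_infinite_partition:
  fixes i :: "'a::boolean_algebra \<Rightarrow> 'c::boolean_algebra" and j :: "'b::boolean_algebra \<Rightarrow> 'c"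
  assumes fp: "free_product i j" and hom: "homogeneous_ba TYPE('a)" and inf: "infinite (UNIV :: 'a set)"
  obtains P :: "'c set" where "ba_partition P" "infinite P"
proof -
  obtain d :: "nat \<Rightarrow> 'a" where d: "\<And>n. d n \<noteq> bot" "\<And>m n. m \<noteq> n \<Longrightarrow> inf (d m) (d n) = bot"
    using homogeneous_infinite_antichain[OF hom inf] by metis
  have i: "ba_hom i" "inj i" using fp by (simp_all add: free_product_def)
  have nz: "i (d n) \<noteq> bot" for n using i d(1) by (metis ba_hom_def injD)
  have disj: "inf (i (d m)) (i (d n)) = bot" if "m \<noteq> n" for m n
    using i(1) d(2)[OF that] by (metis ba_hom_def)
  have "inj (\<lambda>n. i (d n))" by (rule injI) (metis disj nz inf.idem)
  then have "infinite (range (\<lambda>n. i (d n)))" by (simp add: finite_image_iff)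
  moreover obtain P where "ba_partition P" "range (\<lambda>n. i (d n)) \<subseteq> P"
  proof (rule antichain_extends_to_partition[of "range (\<lambda>n. i (d n))"])
    show "bot \<notin> range (\<lambda>n. i (d n))" using nz by (metis rangeE)
    show "\<forall>a\<in>range (\<lambda>n. i (d n)). \<forall>b\<in>range (\<lambda>n. i (d n)). a \<noteq> b \<longrightarrow> inf a b = bot"
      by (intro ballI impI, elim rangeE) (metis disj)
  qed blast
  ultimately show ?thesis using that finite_subset by blast
qed

theorem theorem2:
  fixes i :: "'a::boolean_algebra \<Rightarrow> 'c::boolean_algebra"
    and j :: "'b::boolean_algebra \<Rightarrow> 'c"
  assumes "infinite (UNIV :: 'a set)" and "infinite (UNIV :: 'b set)"
    and "homogeneous_ba TYPE('a)" and "homogeneous_ba TYPE('b)"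
    and "cardSuc natLeq \<le>o partition_number TYPE('a)"
    and "cardSuc natLeq \<le>o partition_number TYPE('b)"
    and "free_product i j"
  shows "card_min (partition_number TYPE('a))
           (card_min (partition_number TYPE('b))
             (card_max (splitting_number TYPE('a)) (splitting_number TYPE('b))))
         \<le>o partition_number TYPE('c)"
proof -
  obtain P0 :: "'c set" where "ba_partition P0" "infinite P0"
    by (rule free_product_infinite_partition[OF assms(7,3,1)])
  then have "{P :: 'c set. ba_partition P \<and> infinite P} \<noteq> {}" by blast
  from least_card_attained[OF this]
  obtain P :: "'c set" where P: "ba_partition P" "infinite P" and eq: "partition_number TYPE('c) = |P|"
    unfolding partition_number_def by blast
  \<comment> \<open>If neither partition number is at most \<open>|P|\<close>, the bound applies in
    both orders of the factors and puts both splitting numbers, hence their maximum, below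
    \<open>|P|\<close>.\<close>
  have "partition_number TYPE('a) \<le>o |P| \<or> partition_number TYPE('b) \<le>o |P| \<or>
      (splitting_number TYPE('a) \<le>o |P| \<and> splitting_number TYPE('b) \<le>o |P| )"
    using free_product_partition_bound[OF assms(7,3) P]
      free_product_partition_bound[OF free_product_commute[OF assms(7)] assms(4) P] by blast
  moreover have "Card_order (partition_number TYPE('a))" "Card_order (partition_number TYPE('b))"
    "Card_order (splitting_number TYPE('a))" "Card_order (splitting_number TYPE('b))"
    by (simp_all add: partition_number_def splitting_number_def Card_order_least_card)
  ultimately show ?thesis
    unfolding eq by (meson card_min_ordLeq card_max_ordLeq Card_order_card_min Card_order_card_max)
qed

end
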